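(* Let $G$ be a connected graph and $n\ge 1$. Then player B wins the general position avoidance game on the lexicographic product $G\circ K_n$ if and only if player B wins the general position avoidance game on $G$ and $n$ is odd.
   Context: The lexicographic product $G\circ H$ has vertex set $V(G)\times V(H)$, with $(g,h)$ adjacent to $(g',h')$ iff either $gg'\in E(G)$, or $g=g'$ and $hh'\in E(H)$. A set $S$ of vertices of a graph is a general position set if no three distinct vertices of $S$ lie on a common shortest path. In the general position avoidance game on a graph, players A and B alternately select vertices, with A moving first; a selection is legal if the vertex was not selected before and the set of all selected vertices is a general position set. The game ends when no legal move remains, and the player who selects the last vertex loses. "Player X wins" means X has a winning strategy. *)

theory Defs
  imports "Graph_Theory.Kuratowski" "Graph_Theory.Vertex_Walk"
begin

text \<open>
  A simple graph is a symmetric loop-free relation on a vertex set; each edge is the pair of its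
  two arcs. It is not required to be finite.
\<close>

abbreviation simple_graph :: "'a pair_pre_digraph \<Rightarrow> bool" where
  "simple_graph G \<equiv> pair_bidirected_digraph G"

definition lexicographic_product ::
    "'a pair_pre_digraph \<Rightarrow> 'b pair_pre_digraph \<Rightarrow> ('a \<times> 'b) pair_pre_digraph" where
  "lexicographic_product G H =
    \<lparr> pverts = pverts G \<times> pverts H,
      parcs = {((g, h), (g', h')) | g h g' h'.
        (g, h) \<in> pverts G \<times> pverts H \<and> (g', h') \<in> pverts G \<times> pverts H \<and>
        ((g, g') \<in> parcs G \<or> g = g' \<and> (h, h') \<in> parcs H)} \<rparr>"

definition shortest_path :: "'a pair_pre_digraph \<Rightarrow> 'a list \<Rightarrow> bool" where
  "shortest_path G p \<longleftrightarrow> vpath p (with_proj G) \<and>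
    (\<forall>q. vpath q (with_proj G) \<and> hd q = hd p \<and> last q = last p
      \<longrightarrow> vwalk_length p \<le> vwalk_length q)"

definition general_position_set :: "'a pair_pre_digraph \<Rightarrow> 'a set \<Rightarrow> bool" where
  "general_position_set G S \<longleftrightarrow> S \<subseteq> pverts G \<and>
    \<not> (\<exists>x\<in>S. \<exists>y\<in>S. \<exists>z\<in>S. x \<noteq> y \<and> x \<noteq> z \<and> y \<noteq> z \<and>
        (\<exists>p. shortest_path G p \<and> {x, y, z} \<subseteq> set p))"

text \<open>
  A position of the game is the list of the vertices selected so far, in the order of selection.
\<close>

datatype player = Player_A | Player_B

definition to_move :: "'a list \<Rightarrow> player" where
  "to_move xs = (if even (length xs) then Player_A else Player_B)"

definition legal_moves :: "'a pair_pre_digraph \<Rightarrow> 'a list \<Rightarrow> 'a set" where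
  "legal_moves G xs =
    {v \<in> pverts G. v \<notin> set xs \<and> general_position_set G (insert v (set xs))}"

definition legal_play :: "'a pair_pre_digraph \<Rightarrow> 'a list \<Rightarrow> bool" where
  "legal_play G xs \<longleftrightarrow> (\<forall>i<length xs. xs ! i \<in> legal_moves G (take i xs))"

definition game_over :: "'a pair_pre_digraph \<Rightarrow> 'a list \<Rightarrow> bool" where
  "game_over G xs \<longleftrightarrow> legal_moves G xs = {}"

definition selected_last :: "player \<Rightarrow> 'a list \<Rightarrow> bool" where
  "selected_last X xs \<longleftrightarrow> xs \<noteq> [] \<and> to_move (butlast xs) = X"

fun opponent :: "player \<Rightarrow> player" where
  "opponent Player_A = Player_B"
| "opponent Player_B = Player_A"

definition follows :: "player \<Rightarrow> ('a list \<Rightarrow> 'a) \<Rightarrow> 'a list \<Rightarrow> bool" where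
  "follows X \<sigma> xs \<longleftrightarrow>
    (\<forall>i<length xs. to_move (take i xs) = X \<longrightarrow> xs ! i = \<sigma> (take i xs))"

text \<open>
  The last conjunct requires that the game comes to an end; it is only relevant for infinite
  graphs, where a play that goes on forever is won by nobody.
\<close>

definition avoidance_winning_strategy ::
    "'a pair_pre_digraph \<Rightarrow> player \<Rightarrow> ('a list \<Rightarrow> 'a) \<Rightarrow> bool" where
  "avoidance_winning_strategy G X \<sigma> \<longleftrightarrow>
    (\<forall>xs. legal_play G xs \<and> follows X \<sigma> xs \<and> \<not> game_over G xs \<and> to_move xs = X
      \<longrightarrow> \<sigma> xs \<in> legal_moves G xs) \<and>
    (\<forall>xs. legal_play G xs \<and> follows X \<sigma> xs \<and> game_over G xs
      \<longrightarrow> selected_last (opponent X) xs) \<and>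
    \<not> (\<exists>f :: nat \<Rightarrow> 'a. \<forall>k. legal_play G (map f [0..<k]) \<and> follows X \<sigma> (map f [0..<k]))"

definition wins_avoidance_game :: "player \<Rightarrow> 'a pair_pre_digraph \<Rightarrow> bool" where
  "wins_avoidance_game X G \<longleftrightarrow> (\<exists>\<sigma>. avoidance_winning_strategy G X \<sigma>)"

end

theory Submission
  imports Defs
begin

text \<open>
  In \<open>G \<circ> K\<^sub>n\<close>, shortest paths with at least three vertices project to shortest paths of \<open>G\<close>, and
  every shortest path of \<open>G\<close> lifts through prescribed heights, so a set is in general position in
  the product iff its projection to \<open>G\<close> is. Hence a maximal general position set of the product is a
  union of complete fibres. If \<open>n\<close> is even, every finished play therefore has even length and B made
  the last move. If \<open>n\<close> is odd, opening a fibre leaves an even number of further places in it, which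
  act as passes: a pass is always answered by a pass, and what remains is the game on \<open>G\<close>.
\<close>

section \<open>Shortest paths in lexicographic products\<close>

lemma pverts_lexicographic_product [simp]:
  "pverts (lexicographic_product G H) = pverts G \<times> pverts H"
  by (simp add: lexicographic_product_def)

lemma parcs_lexicographic_product:
  "(u, v) \<in> parcs (lexicographic_product G H) \<longleftrightarrow>
    u \<in> pverts G \<times> pverts H \<and> v \<in> pverts G \<times> pverts H \<and>
    ((fst u, fst v) \<in> parcs G \<or> fst u = fst v \<and> (snd u, snd v) \<in> parcs H)"
  by (cases u; cases v) (auto simp: lexicographic_product_def)

lemma shortest_path_length_le:
  assumes "shortest_path G p" "vpath q (with_proj G)" "hd q = hd p" "last q = last p"
  shows "length p \<le> length q"
proof -
  have "q \<noteq> []" using assms(2) by auto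
  moreover have "length p - 1 \<le> length q - 1" using assms by (simp add: shortest_path_def)
  ultimately show ?thesis by (cases q) simp_all
qed

lemma shortest_pathI:
  assumes "vpath p (with_proj G)"
    and "\<And>q. vpath q (with_proj G) \<Longrightarrow> hd q = hd p \<Longrightarrow> last q = last p \<Longrightarrow> length p \<le> length q"
  shows "shortest_path G p"
  using assms by (auto simp: shortest_path_def intro!: diff_le_mono)

lemma vpath_ends_in_pverts:
  assumes "vpath p (with_proj G)"
  shows "hd p \<in> pverts G" and "last p \<in> pverts G"
proof -
  have "p \<noteq> []" "set p \<subseteq> pverts G"
    using assms by (auto simp: vpath_def vwalk_def)
  then show "hd p \<in> pverts G" "last p \<in> pverts G"
    using hd_in_set last_in_set by blast+
qed

lemma vwalk_arcs_map: "vwalk_arcs (map f p) = map (map_prod f f) (vwalk_arcs p)"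
  by (induction p rule: vwalk_arcs.induct) auto

lemma vpath_lift_lexicographic_product:
  assumes "vpath p (with_proj G)" "height ` set p \<subseteq> pverts H"
  shows "vpath (map (\<lambda>g. (g, height g)) p) (with_proj (lexicographic_product G H))"
proof (intro vpathI vwalkI)
  have "p \<noteq> []" "distinct p" and verts: "set p \<subseteq> pverts G" and arcs: "set (vwalk_arcs p) \<subseteq> parcs G"
    using assms(1) by (auto simp: vpath_def vwalk_def)
  then show "map (\<lambda>g. (g, height g)) p \<noteq> []" "distinct (map (\<lambda>g. (g, height g)) p)"
    by (auto simp: distinct_map inj_on_def)
  show "set (map (\<lambda>g. (g, height g)) p) \<subseteq> verts (with_proj (lexicographic_product G H))"
    using verts assms(2) by auto
  show "set (vwalk_arcs (map (\<lambda>g. (g, height g)) p)) \<subseteq>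
      arcs_ends (with_proj (lexicographic_product G H))"
  proof
    fix e assume "e \<in> set (vwalk_arcs (map (\<lambda>g. (g, height g)) p))"
    then obtain g g' where e_eq: "e = ((g, height g), (g', height g'))"
      and arc: "(g, g') \<in> set (vwalk_arcs p)"
      by (auto simp: vwalk_arcs_map)
    from arcs_in_vwalk_arcs[OF arc] have "g \<in> set p" "g' \<in> set p" by simp_all
    with arc e_eq verts arcs assms(2) show "e \<in> arcs_ends (with_proj (lexicographic_product G H))"
      by (auto simp: parcs_lexicographic_product)
  qed
qed

lemma vwalk_lexicographic_product_project:
  assumes "vwalk q (with_proj (lexicographic_product G H))"
  obtains r where "vpath r (with_proj G)" "hd r = fst (hd q)" "last r = fst (last q)"
    "set r \<subseteq> fst ` set q"
proof -
  have "\<exists>r. vwalk r (with_proj G) \<and> hd r = fst (hd q) \<and> last r = fst (last q) \<and> set r \<subseteq> fst ` set q"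
    using assms
  proof (induction rule: vwalk_induct)
    case (Base u)
    then show ?case by (intro exI[of _ "[fst u]"]) auto
  next
    case (Cons u v es)
    then obtain r where r: "vwalk r (with_proj G)" "hd r = fst v" "last r = fst (last (v # es))"
      "set r \<subseteq> fst ` set (v # es)" by auto
    show ?case
    proof (cases "fst u = fst v")
      case True
      with r show ?thesis by (intro exI[of _ r]) auto
    next
      case False
      with Cons.hyps r(2) have "fst u \<in> pverts G" "(fst u, hd r) \<in> parcs G"
        by (auto simp: parcs_lexicographic_product)
      then have "vwalk (fst u # r) (with_proj G)"
        using r(1) by (simp add: vwalk_consI)
      moreover have "r \<noteq> []" using r(1) by auto
      ultimately show ?thesis using r by (intro exI[of _ "fst u # r"]) auto
    qed
  qed
  then obtain r where "vwalk r (with_proj G)" "hd r = fst (hd q)" "last r = fst (last q)"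
    "set r \<subseteq> fst ` set q" by blast
  then show thesis
    using that[of "vwalk_to_vpath r"] vwalk_to_vpath_vpath
    by (auto simp: vwalk_to_vpath_hd vwalk_to_vpath_last dest: vwalk_to_vpath_subset)
qed

lemma shortest_path_lift_lexicographic_product:
  assumes "shortest_path G p" "height ` set p \<subseteq> pverts H"
  shows "shortest_path (lexicographic_product G H) (map (\<lambda>g. (g, height g)) p)"
proof (rule shortest_pathI)
  have p: "vpath p (with_proj G)" using assms(1) by (simp add: shortest_path_def)
  then have "p \<noteq> []" by auto
  show "vpath (map (\<lambda>g. (g, height g)) p) (with_proj (lexicographic_product G H))"
    using p assms(2) by (rule vpath_lift_lexicographic_product)
  fix q
  assume q: "vpath q (with_proj (lexicographic_product G H))"
    "hd q = hd (map (\<lambda>g. (g, height g)) p)" "last q = last (map (\<lambda>g. (g, height g)) p)"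
  then obtain r where r: "vpath r (with_proj G)" "hd r = fst (hd q)" "last r = fst (last q)"
    "set r \<subseteq> fst ` set q"
    using vwalk_lexicographic_product_project by blast
  have "length p \<le> length r"
    using assms(1) r(1)
    by (rule shortest_path_length_le) (simp_all add: r(2,3) q(2,3) hd_map last_map \<open>p \<noteq> []\<close>)
  also have "\<dots> = card (set r)" using r(1) by (auto simp: distinct_card)
  also have "\<dots> \<le> card (set q)" using r(4) by (rule surj_card_le[rotated]) simp
  also have "\<dots> \<le> length q" by (rule card_length)
  finally show "length (map (\<lambda>g. (g, height g)) p) \<le> length q" by simp
qed

lemma length_le_of_shortest_path_lexicographic_product:
  assumes p: "shortest_path (lexicographic_product G H) p"
    and ends: "fst (hd p) \<noteq> fst (last p)"
    and q: "vpath q (with_proj G)" "hd q = fst (hd p)" "last q = fst (last p)"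
  shows "length p \<le> length q"
proof -
  define height where "height = (\<lambda>_. snd (last p))(fst (hd p) := snd (hd p))"
  have path: "vpath p (with_proj (lexicographic_product G H))"
    using p by (simp add: shortest_path_def)
  have lift: "vpath (map (\<lambda>g. (g, height g)) q) (with_proj (lexicographic_product G H))"
    using vpath_ends_in_pverts[OF path]
    by (intro vpath_lift_lexicographic_product[OF q(1)]) (auto simp: height_def mem_Times_iff)
  have "q \<noteq> []" using q(1) by auto
  then show ?thesis
    using shortest_path_length_le[OF p lift] q(2,3) ends by (simp add: hd_map last_map height_def)
qed

text \<open>The bound on the length is needed: the two ends of an arc inside a fibre form a shortest path
  with a single projection.\<close>

lemma shortest_path_lexicographic_product_fst_ends:
  assumes complete: "pairwise (\<lambda>h h'. (h, h') \<in> parcs H) (pverts H)"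
    and p: "shortest_path (lexicographic_product G H) p" and "3 \<le> length p"
  shows "fst (hd p) \<noteq> fst (last p)"
proof
  assume same_fibre: "fst (hd p) = fst (last p)"
  have path: "vpath p (with_proj (lexicographic_product G H))"
    using p by (simp add: shortest_path_def)
  then have "hd p \<noteq> last p"
    using \<open>3 \<le> length p\<close> by (cases p) auto
  then have "vpath [hd p, last p] (with_proj (lexicographic_product G H))"
    using vpath_ends_in_pverts[OF path] same_fibre complete
    by (auto simp: vpath_def vwalk_def parcs_lexicographic_product prod_eq_iff pairwise_def)
  from shortest_path_length_le[OF p this] \<open>3 \<le> length p\<close> show False by simp
qed

lemma shortest_path_project_lexicographic_product:
  assumes complete: "pairwise (\<lambda>h h'. (h, h') \<in> parcs H) (pverts H)"
    and p: "shortest_path (lexicographic_product G H) p" and "3 \<le> length p"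
  obtains r where "shortest_path G r" "set r = fst ` set p" "inj_on fst (set p)"
proof -
  have path: "vpath p (with_proj (lexicographic_product G H))"
    using p by (simp add: shortest_path_def)
  note shortest = length_le_of_shortest_path_lexicographic_product[OF p
      shortest_path_lexicographic_product_fst_ends[OF complete p \<open>3 \<le> length p\<close>]]
  obtain r where r: "vpath r (with_proj G)" "hd r = fst (hd p)" "last r = fst (last p)"
    "set r \<subseteq> fst ` set p"
    using path vwalk_lexicographic_product_project by blast
  have "length p \<le> card (set r)"
    using shortest[OF r(1-3)] r(1) by (auto simp: distinct_card)
  moreover have "card (set r) \<le> card (fst ` set p)"
    using r(4) by (simp add: card_mono)
  moreover have "card (fst ` set p) \<le> card (set p)" "card (set p) \<le> length p"
    by (simp_all add: card_image_le card_length)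
  ultimately have card_eq: "card (set r) = card (fst ` set p)" "card (fst ` set p) = card (set p)"
    and "length r = length p"
    using r(1) by (auto simp: distinct_card)
  show thesis
  proof
    show "shortest_path G r"
      using r(1) by (rule shortest_pathI) (use shortest r(2,3) \<open>length r = length p\<close> in simp)
    show "set r = fst ` set p" using r(4) card_eq(1) by (simp add: card_subset_eq)
    show "inj_on fst (set p)" using card_eq(2) by (simp add: eq_card_imp_inj_on)
  qed
qed

section \<open>General position in lexicographic products\<close>

lemma card_le_two_iff:
  assumes "finite A"
  shows "card A \<le> 2 \<longleftrightarrow> \<not> (\<exists>x\<in>A. \<exists>y\<in>A. \<exists>z\<in>A. x \<noteq> y \<and> x \<noteq> z \<and> y \<noteq> z)"
proof
  assume "card A \<le> 2"
  then show "\<not> (\<exists>x\<in>A. \<exists>y\<in>A. \<exists>z\<in>A. x \<noteq> y \<and> x \<noteq> z \<and> y \<noteq> z)"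
    using card_mono[OF assms, of "{_, _, _}"] by fastforce
next
  assume no_three: "\<not> (\<exists>x\<in>A. \<exists>y\<in>A. \<exists>z\<in>A. x \<noteq> y \<and> x \<noteq> z \<and> y \<noteq> z)"
  show "card A \<le> 2"
  proof (rule ccontr)
    assume "\<not> card A \<le> 2"
    then obtain T where "T \<subseteq> A" "card T = 3"
      using obtain_subset_with_card_n[of 3 A] by auto
    with no_three show False by (auto simp: card_3_iff)
  qed
qed

lemma general_position_set_iff_card:
  "general_position_set G S \<longleftrightarrow>
    S \<subseteq> pverts G \<and> (\<forall>p. shortest_path G p \<longrightarrow> card (S \<inter> set p) \<le> 2)"
  by (simp add: card_le_two_iff general_position_set_def) blast

lemma general_position_set_fst_image:
  assumes gp: "general_position_set (lexicographic_product G H) S"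
  shows "general_position_set G (fst ` S)"
  unfolding general_position_set_iff_card
proof (intro conjI allI impI)
  have S: "S \<subseteq> pverts G \<times> pverts H" using gp by (simp add: general_position_set_iff_card)
  then show "fst ` S \<subseteq> pverts G" by auto
  fix p assume p: "shortest_path G p"
  show "card (fst ` S \<inter> set p) \<le> 2"
  proof (cases "S = {}")
    case False
    with S have "\<exists>h\<in>pverts H. \<forall>h'. (g, h') \<in> S \<longrightarrow> (g, h) \<in> S" for g
      by (cases "\<exists>h'. (g, h') \<in> S") auto
    then obtain height where height: "\<And>g. height g \<in> pverts H"
      "\<And>g h. (g, h) \<in> S \<Longrightarrow> (g, height g) \<in> S"
      by metis
    let ?lift = "\<lambda>g. (g, height g)"
    have "card (fst ` S \<inter> set p) \<le> card (S \<inter> set (map ?lift p))"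
      by (rule card_inj_on_le[of ?lift]) (auto simp: inj_on_def intro: height(2))
    also have "\<dots> \<le> 2"
      using gp shortest_path_lift_lexicographic_product[OF p, of height H] height(1)
      unfolding general_position_set_iff_card by blast
    finally show ?thesis .
  qed simp
qed

lemma general_position_set_of_fst_image:
  assumes complete: "pairwise (\<lambda>h h'. (h, h') \<in> parcs H) (pverts H)"
    and "S \<subseteq> UNIV \<times> pverts H" and gp: "general_position_set G (fst ` S)"
  shows "general_position_set (lexicographic_product G H) S"
  unfolding general_position_set_iff_card
proof (intro conjI allI impI)
  show "S \<subseteq> pverts (lexicographic_product G H)"
    using assms(2) gp by (force simp: general_position_set_iff_card)
  fix p assume p: "shortest_path (lexicographic_product G H) p"
  show "card (S \<inter> set p) \<le> 2"
  proof (cases "3 \<le> length p")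
    case True
    obtain r where r: "shortest_path G r" "set r = fst ` set p" "inj_on fst (set p)"
      by (rule shortest_path_project_lexicographic_product[OF complete p True])
    have "card (S \<inter> set p) \<le> card (fst ` S \<inter> set r)"
      by (rule card_inj_on_le[of fst]) (use r(2,3) in \<open>auto intro: inj_on_subset\<close>)
    also have "\<dots> \<le> 2" using gp r(1) by (simp add: general_position_set_iff_card)
    finally show ?thesis .
  next
    case False
    have "card (S \<inter> set p) \<le> card (set p)" by (simp add: card_mono)
    also have "\<dots> \<le> length p" by (rule card_length)
    finally show ?thesis using False by simp
  qed
qed

lemma general_position_set_lexicographic_product:
  assumes complete: "pairwise (\<lambda>h h'. (h, h') \<in> parcs H) (pverts H)"
  shows "general_position_set (lexicographic_product G H) S \<longleftrightarrow>
    S \<subseteq> UNIV \<times> pverts H \<and> general_position_set G (fst ` S)"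
  using general_position_set_fst_image[of G H S]
    general_position_set_of_fst_image[OF complete, of S G]
  unfolding general_position_set_iff_card[of "lexicographic_product G H"] by auto

section \<open>The avoidance game on a set family\<close>

definition moves :: "('a set \<Rightarrow> bool) \<Rightarrow> 'a set \<Rightarrow> 'a set" where
  "moves F S = {v. v \<notin> S \<and> F (insert v S)}"

text \<open>Being inductive, both predicates demand that the game ends; on an infinite family a position
  may satisfy neither.\<close>

inductive mover_wins :: "('a set \<Rightarrow> bool) \<Rightarrow> 'a set \<Rightarrow> bool"
  and mover_loses :: "('a set \<Rightarrow> bool) \<Rightarrow> 'a set \<Rightarrow> bool"
  for F where
  stuck: "moves F S = {} \<Longrightarrow> mover_wins F S"
| some_move: "v \<in> moves F S \<Longrightarrow> mover_loses F (insert v S) \<Longrightarrow> mover_wins F S"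
| all_moves: "moves F S \<noteq> {} \<Longrightarrow> (\<And>v. v \<in> moves F S \<Longrightarrow> mover_wins F (insert v S)) \<Longrightarrow>
    mover_loses F S"

lemma mover_wins_iff:
  "mover_wins F S \<longleftrightarrow> moves F S = {} \<or> (\<exists>v\<in>moves F S. mover_loses F (insert v S))"
  by (subst mover_wins.simps) auto

lemma mover_loses_iff:
  "mover_loses F S \<longleftrightarrow> moves F S \<noteq> {} \<and> (\<forall>v\<in>moves F S. mover_wins F (insert v S))"
  by (subst mover_loses.simps) auto

lemma even_maximal_sets_parity:
  assumes even_maximal: "\<And>T. finite T \<Longrightarrow> F T \<Longrightarrow> moves F T = {} \<Longrightarrow> even (card T)"
  shows "mover_wins F S \<Longrightarrow> finite S \<Longrightarrow> F S \<Longrightarrow> even (card S)"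
    and "mover_loses F S \<Longrightarrow> finite S \<Longrightarrow> F S \<Longrightarrow> odd (card S)"
proof (induction S and S rule: mover_wins_mover_loses.inducts)
  case (stuck S)
  then show ?case using even_maximal by blast
next
  case (some_move v S)
  then show ?case by (auto simp: moves_def)
next
  case (all_moves S)
  then obtain v where "v \<in> moves F S" by blast
  moreover from this have "even (card (insert v S))"
    using all_moves unfolding moves_def by blast
  ultimately show ?case using \<open>finite S\<close> by (simp add: moves_def)
qed

section \<open>Strategies and forced wins\<close>

lemma legal_moves_eq_moves: "legal_moves G xs = moves (general_position_set G) (set xs)"
  by (auto simp: legal_moves_def moves_def general_position_set_def)

lemma to_move_Nil [simp]: "to_move [] = Player_A"
  by (simp add: to_move_def)

lemma to_move_snoc [simp]: "to_move (xs @ [v]) = opponent (to_move xs)"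
  by (simp add: to_move_def)

lemma opponent_eq_iff [simp]: "opponent X = Y \<longleftrightarrow> X \<noteq> Y" "Y = opponent X \<longleftrightarrow> X \<noteq> Y"
  by (cases X; cases Y; simp)+

lemma selected_last_iff: "selected_last X xs \<longleftrightarrow> xs \<noteq> [] \<and> to_move xs \<noteq> X"
  by (cases xs rule: rev_cases) (auto simp: selected_last_def)

definition consistent_moves :: "'a pair_pre_digraph \<Rightarrow> player \<Rightarrow> ('a list \<Rightarrow> 'a) \<Rightarrow> 'a list \<Rightarrow> 'a set"
  where "consistent_moves G X \<sigma> xs = {v \<in> legal_moves G xs. to_move xs = X \<longrightarrow> v = \<sigma> xs}"

definition consistent_play :: "'a pair_pre_digraph \<Rightarrow> player \<Rightarrow> ('a list \<Rightarrow> 'a) \<Rightarrow> 'a list \<Rightarrow> bool"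
  where "consistent_play G X \<sigma> xs \<longleftrightarrow> legal_play G xs \<and> follows X \<sigma> xs"

lemma consistent_play_Nil [simp]: "consistent_play G X \<sigma> []"
  by (simp add: consistent_play_def legal_play_def follows_def)

lemma consistent_play_snoc [simp]:
  "consistent_play G X \<sigma> (xs @ [v]) \<longleftrightarrow>
    consistent_play G X \<sigma> xs \<and> v \<in> consistent_moves G X \<sigma> xs"
  by (auto simp: consistent_play_def consistent_moves_def legal_play_def follows_def
      less_Suc_eq nth_append)

text \<open>Player A does not win when stuck before the first move, as then nobody has selected a last
  vertex.\<close>

lemma avoidance_winning_strategy_iff_consistent_play:
  assumes "X = Player_B \<or> \<not> game_over G []"
  shows "avoidance_winning_strategy G X \<sigma> \<longleftrightarrow>
    (\<forall>xs. consistent_play G X \<sigma> xs \<longrightarrow>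
      consistent_moves G X \<sigma> xs \<noteq> {} \<or> game_over G xs \<and> to_move xs = X) \<and>
    \<not> (\<exists>f. \<forall>k. consistent_play G X \<sigma> (map f [0..<k]))"
proof -
  have safe_iff: "consistent_moves G X \<sigma> xs \<noteq> {} \<or> game_over G xs \<and> to_move xs = X \<longleftrightarrow>
      (\<not> game_over G xs \<and> to_move xs = X \<longrightarrow> \<sigma> xs \<in> legal_moves G xs) \<and>
      (game_over G xs \<longrightarrow> selected_last (opponent X) xs)" for xs
  proof -
    have "xs \<noteq> []" if "game_over G xs" "to_move xs = X"
      using that assms by auto
    then show ?thesis
      by (auto simp: consistent_moves_def game_over_def selected_last_iff)
  qed
  show ?thesis
    unfolding avoidance_winning_strategy_def consistent_play_def safe_iff by blast
qed

inductive strategy_wins :: "'a pair_pre_digraph \<Rightarrow> player \<Rightarrow> ('a list \<Rightarrow> 'a) \<Rightarrow> 'a list \<Rightarrow> bool"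
  for G X \<sigma> where
  strategy_winsI: "consistent_moves G X \<sigma> xs \<noteq> {} \<or> game_over G xs \<and> to_move xs = X \<Longrightarrow>
    (\<And>v. v \<in> consistent_moves G X \<sigma> xs \<Longrightarrow> strategy_wins G X \<sigma> (xs @ [v])) \<Longrightarrow>
    strategy_wins G X \<sigma> xs"

lemma strategy_wins_consistent_play:
  assumes "strategy_wins G X \<sigma> []" "consistent_play G X \<sigma> xs"
  shows "strategy_wins G X \<sigma> xs"
  using assms(2)
proof (induction xs rule: rev_induct)
  case Nil
  show ?case by (rule assms(1))
next
  case (snoc v xs)
  then have "strategy_wins G X \<sigma> xs" "v \<in> consistent_moves G X \<sigma> xs" by simp_all
  then show ?case by cases
qed

lemma strategy_wins_imp_no_infinite_play:
  assumes "strategy_wins G X \<sigma> (map f [0..<n])"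
  shows "\<exists>k. \<not> consistent_play G X \<sigma> (map f [0..<k])"
  using assms
proof (induction "map f [0..<n]" arbitrary: n rule: strategy_wins.induct)
  case strategy_winsI
  show ?case
  proof (cases "consistent_play G X \<sigma> (map f [0..<Suc n])")
    case True
    then have "f n \<in> consistent_moves G X \<sigma> (map f [0..<n])" by simp
    then show ?thesis using strategy_winsI.hyps(3)[of "f n" "Suc n"] by simp
  qed blast
qed

lemma infinite_branch:
  assumes "P []" and "\<And>xs. P xs \<Longrightarrow> \<exists>v. P (xs @ [v])"
  obtains f where "\<And>k. P (map f [0..<k])"
proof -
  have "\<exists>p. \<forall>k. (P (p k) \<and> length (p k) = k) \<and> (\<exists>v. p (Suc k) = p k @ [v])"
    by (rule dependent_nat_choice) (use assms in \<open>fastforce+\<close>)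
  then obtain p where p: "\<And>k. P (p k)" "\<And>k. length (p k) = k" "\<And>k. \<exists>v. p (Suc k) = p k @ [v]"
    by blast
  from p(3) obtain f where f: "\<And>k. p (Suc k) = p k @ [f k]" by metis
  have "p k = map f [0..<k]" for k
    using p(2)[of 0] by (induction k) (simp_all add: f)
  with p(1) that show thesis by metis
qed

lemma avoidance_winning_strategy_iff_strategy_wins:
  assumes "X = Player_B \<or> \<not> game_over G []"
  shows "avoidance_winning_strategy G X \<sigma> \<longleftrightarrow> strategy_wins G X \<sigma> []"
proof
  assume win: "strategy_wins G X \<sigma> []"
  have "consistent_moves G X \<sigma> xs \<noteq> {} \<or> game_over G xs \<and> to_move xs = X"
    if "consistent_play G X \<sigma> xs" for xs
    using strategy_wins_consistent_play[OF win that] by cases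
  moreover have "\<exists>k. \<not> consistent_play G X \<sigma> (map f [0..<k])" for f
    using win strategy_wins_imp_no_infinite_play[of G X \<sigma> f 0] by simp
  ultimately show "avoidance_winning_strategy G X \<sigma>"
    by (simp add: avoidance_winning_strategy_iff_consistent_play[OF assms])
next
  assume win: "avoidance_winning_strategy G X \<sigma>"
  show "strategy_wins G X \<sigma> []"
  proof (rule ccontr)
    assume "\<not> strategy_wins G X \<sigma> []"
    define unresolved where
      "unresolved xs \<longleftrightarrow> consistent_play G X \<sigma> xs \<and> \<not> strategy_wins G X \<sigma> xs" for xs
    have "\<exists>v. unresolved (xs @ [v])" if xs: "unresolved xs" for xs
    proof (rule ccontr)
      assume "\<not> (\<exists>v. unresolved (xs @ [v]))"
      with xs have "strategy_wins G X \<sigma> (xs @ [v])" if "v \<in> consistent_moves G X \<sigma> xs" for v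
        using that by (simp add: unresolved_def)
      moreover have "consistent_moves G X \<sigma> xs \<noteq> {} \<or> game_over G xs \<and> to_move xs = X"
        using win xs
        unfolding avoidance_winning_strategy_iff_consistent_play[OF assms] unresolved_def by blast
      ultimately have "strategy_wins G X \<sigma> xs" by (rule strategy_winsI[rotated])
      with xs show False by (simp add: unresolved_def)
    qed
    moreover have "unresolved []"
      using \<open>\<not> strategy_wins G X \<sigma> []\<close> by (simp add: unresolved_def)
    ultimately obtain f where "\<And>k. unresolved (map f [0..<k])"
      using infinite_branch[of unresolved] by blast
    with win show False
      unfolding avoidance_winning_strategy_iff_consistent_play[OF assms] unresolved_def by blast
  qed
qed

lemma strategy_wins_imp_mover:
  assumes "strategy_wins G X \<sigma> xs"
  shows "if to_move xs = X then mover_wins (general_position_set G) (set xs)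
    else mover_loses (general_position_set G) (set xs)"
  using assms
proof (induction xs rule: strategy_wins.induct)
  case (strategy_winsI xs)
  show ?case
  proof (cases "to_move xs = X")
    case True
    with strategy_winsI show ?thesis
      by (auto simp: mover_wins_iff consistent_moves_def game_over_def legal_moves_eq_moves)
  next
    case False
    with strategy_winsI show ?thesis
      by (auto simp: mover_loses_iff consistent_moves_def legal_moves_eq_moves)
  qed
qed

lemma strategy_wins_cong:
  assumes "strategy_wins G X \<sigma> xs" "\<And>zs. \<tau> (xs @ zs) = \<sigma> (xs @ zs)"
  shows "strategy_wins G X \<tau> xs"
  using assms
proof (induction xs rule: strategy_wins.induct)
  case (strategy_winsI xs)
  have "consistent_moves G X \<tau> xs = consistent_moves G X \<sigma> xs"
    using strategy_winsI.prems[of "[]"] by (simp add: consistent_moves_def)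
  then show ?case
    by (intro strategy_wins.strategy_winsI[of G X \<tau> xs]) (use strategy_winsI in simp_all)
qed

text \<open>The strategies for the individual continuations are glued together along the history of the
  play. Choosing an arbitrary winning successor at each turn would not do: on an infinite graph it
  could postpone the end of the game forever.\<close>

lemma mover_imp_strategy_wins:
  shows "mover_wins (general_position_set G) S \<Longrightarrow> set xs = S \<Longrightarrow> to_move xs = X \<Longrightarrow>
      \<exists>\<sigma>. strategy_wins G X \<sigma> xs"
    and "mover_loses (general_position_set G) S \<Longrightarrow> set xs = S \<Longrightarrow> to_move xs \<noteq> X \<Longrightarrow>
      \<exists>\<sigma>. strategy_wins G X \<sigma> xs"
proof (induction S and S arbitrary: xs and xs rule: mover_wins_mover_loses.inducts)
  case (stuck S)
  then have "legal_moves G xs = {}" by (simp add: legal_moves_eq_moves)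
  then have "strategy_wins G X \<sigma> xs" for \<sigma>
    using \<open>to_move xs = X\<close>
    by (intro strategy_winsI[of G X \<sigma> xs]) (simp_all add: consistent_moves_def game_over_def)
  then show ?case by blast
next
  case (some_move v S)
  have "\<exists>\<tau>. strategy_wins G X \<tau> (xs @ [v])"
    using some_move.prems by (intro some_move.IH(3)) simp_all
  then obtain \<tau> where \<tau>: "strategy_wins G X \<tau> (xs @ [v])" ..
  have "strategy_wins G X (\<tau>(xs := v)) (xs @ [v])"
    by (rule strategy_wins_cong[OF \<tau>]) auto
  moreover have "consistent_moves G X (\<tau>(xs := v)) xs = {v}"
    using some_move by (auto simp: consistent_moves_def legal_moves_eq_moves)
  ultimately have "strategy_wins G X (\<tau>(xs := v)) xs"
    by (intro strategy_winsI[of G X _ xs]) simp_all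
  then show ?case by blast
next
  case (all_moves S)
  have "\<exists>\<sigma>. strategy_wins G X \<sigma> (xs @ [v])" if "v \<in> moves (general_position_set G) S" for v
    using that all_moves by auto
  then obtain \<tau> where
    \<tau>: "\<And>v. v \<in> moves (general_position_set G) S \<Longrightarrow> strategy_wins G X (\<tau> v) (xs @ [v])"
    by metis
  define \<sigma> where "\<sigma> ys = \<tau> (ys ! length xs) ys" for ys
  have "strategy_wins G X \<sigma> (xs @ [v])" if "v \<in> moves (general_position_set G) S" for v
    by (rule strategy_wins_cong[OF \<tau>[OF that]]) (simp add: \<sigma>_def)
  moreover have "consistent_moves G X \<sigma> xs = moves (general_position_set G) S"
    using all_moves.prems by (auto simp: consistent_moves_def legal_moves_eq_moves)
  ultimately have "strategy_wins G X \<sigma> xs"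
    using all_moves.IH(1) by (intro strategy_winsI[of G X \<sigma> xs]) simp_all
  then show ?case by blast
qed

lemma wins_avoidance_game_iff:
  assumes "X = Player_B \<or> \<not> game_over G []"
  shows "wins_avoidance_game X G \<longleftrightarrow>
    (if X = Player_A then mover_wins (general_position_set G) {}
     else mover_loses (general_position_set G) {})"
  unfolding wins_avoidance_game_def avoidance_winning_strategy_iff_strategy_wins[OF assms]
  using strategy_wins_imp_mover[of G X _ "[]"] mover_imp_strategy_wins[of G "{}" "[]" X]
  by (cases X) auto

section \<open>Blowing up every element into a fibre\<close>

definition blow_up :: "('a set \<Rightarrow> bool) \<Rightarrow> 'b set \<Rightarrow> ('a \<times> 'b) set \<Rightarrow> bool" where
  "blow_up F K S \<longleftrightarrow> S \<subseteq> UNIV \<times> K \<and> F (fst ` S)"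

definition free_places :: "'b set \<Rightarrow> ('a \<times> 'b) set \<Rightarrow> ('a \<times> 'b) set" where
  "free_places K S = fst ` S \<times> K - S"

lemma finite_free_places: "finite K \<Longrightarrow> finite S \<Longrightarrow> finite (free_places K S)"
  by (simp add: free_places_def)

lemma moves_blow_up:
  assumes "blow_up F K S"
  shows "moves (blow_up F K) S = moves F (fst ` S) \<times> K \<union> free_places K S"
proof (rule set_eqI)
  fix v
  show "v \<in> moves (blow_up F K) S \<longleftrightarrow> v \<in> moves F (fst ` S) \<times> K \<union> free_places K S"
  proof (cases "fst v \<in> fst ` S")
    case True
    then have "insert (fst v) (fst ` S) = fst ` S" by (rule insert_absorb)
    with True assms show ?thesis
      by (simp add: moves_def blow_up_def free_places_def mem_Times_iff) blast
  next
    case False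
    with assms show ?thesis
      by (simp add: moves_def blow_up_def free_places_def mem_Times_iff) blast
  qed
qed

lemma blow_up_insert: "v \<in> moves (blow_up F K) S \<Longrightarrow> blow_up F K (insert v S)"
  by (simp add: moves_def)

lemma fst_image_insert_free_place: "v \<in> free_places K S \<Longrightarrow> fst ` insert v S = fst ` S"
  by (simp add: free_places_def insert_absorb mem_Times_iff)

lemma free_places_insert_free_place:
  assumes "v \<in> free_places K S"
  shows "free_places K (insert v S) = free_places K S - {v}"
  using fst_image_insert_free_place[OF assms] by (auto simp: free_places_def simp del: image_insert)

lemma card_free_places_insert_free_place:
  assumes "finite K" "finite S" "v \<in> free_places K S"
  shows "card (free_places K S) = Suc (card (free_places K (insert v S)))"
  using assms by (metis card_Suc_Diff1 finite_free_places free_places_insert_free_place)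

lemma free_places_insert_new:
  assumes "g \<notin> fst ` S"
  shows "free_places K (insert (g, h) S) = free_places K S \<union> {g} \<times> (K - {h})"
  using assms by (auto simp: free_places_def image_iff)

lemma card_free_places_insert_new:
  assumes "finite K" "finite S" "g \<notin> fst ` S" "h \<in> K"
  shows "card (free_places K (insert (g, h) S)) = card (free_places K S) + (card K - 1)"
proof -
  have "free_places K S \<inter> {g} \<times> (K - {h}) = {}"
    using assms(3) by (auto simp: free_places_def)
  then show ?thesis
    using assms by (simp add: free_places_insert_new card_Un_disjoint finite_free_places
        card_cartesian_product)
qed

text \<open>Over a maximal set only free places can be selected, and they can be selected in any order.\<close>

lemma mover_blow_up_maximal:
  assumes "finite K" "finite S" "blow_up F K S" "moves F (fst ` S) = {}"
  shows "(mover_wins (blow_up F K) S \<longleftrightarrow> even (card (free_places K S))) \<and>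
    (mover_loses (blow_up F K) S \<longleftrightarrow> odd (card (free_places K S)))"
  using assms(2-4)
proof (induction "card (free_places K S)" arbitrary: S)
  case 0
  then have "moves (blow_up F K) S = {}"
    using assms(1) finite_free_places[of K S] by (simp add: moves_blow_up)
  then show ?case
    using "0.hyps" by (simp add: mover_wins_iff[of _ S] mover_loses_iff[of _ S])
next
  case (Suc m)
  have moves: "moves (blow_up F K) S = free_places K S"
    using Suc.prems by (simp add: moves_blow_up)
  have "(mover_wins (blow_up F K) (insert v S) \<longleftrightarrow> even m) \<and>
      (mover_loses (blow_up F K) (insert v S) \<longleftrightarrow> odd m)"
    if v: "v \<in> free_places K S" for v
  proof -
    have "m = card (free_places K (insert v S))"
      using card_free_places_insert_free_place[OF assms(1) Suc.prems(1) v] Suc.hyps(2) by simp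
    moreover have "blow_up F K (insert v S)"
      using v moves by (intro blow_up_insert) simp
    ultimately show ?thesis
      using Suc.hyps(1)[of "insert v S"] Suc.prems fst_image_insert_free_place[OF v] by simp
  qed
  moreover have "free_places K S \<noteq> {}" using Suc.hyps(2) by auto
  ultimately show ?case
    unfolding mover_wins_iff[of _ S] mover_loses_iff[of _ S] moves Suc.hyps(2)[symmetric] by auto
qed

definition balanced :: "('a set \<Rightarrow> bool) \<Rightarrow> 'b set \<Rightarrow> ('a \<times> 'b) set \<Rightarrow> bool" where
  "balanced F K S \<longleftrightarrow> finite S \<and> blow_up F K S \<and> even (card (free_places K S))"

lemma balanced_insert_new:
  assumes "finite K" "odd (card K)" "balanced F K S" "g \<in> moves F (fst ` S)" "h \<in> K"
  shows "(g, h) \<in> moves (blow_up F K) S" and "balanced F K (insert (g, h) S)"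
proof -
  show move: "(g, h) \<in> moves (blow_up F K) S"
    using assms(3-5) by (simp add: balanced_def moves_blow_up)
  have "g \<notin> fst ` S" using assms(4) by (simp add: moves_def)
  with assms blow_up_insert[OF move] show "balanced F K (insert (g, h) S)"
    by (simp add: balanced_def card_free_places_insert_new)
qed

lemma balanced_reply:
  assumes "finite K" "balanced F K S" "v \<in> free_places K S"
  obtains w where "w \<in> free_places K (insert v S)" "w \<in> moves (blow_up F K) (insert v S)"
    "balanced F K (insert w (insert v S))"
    "card (free_places K (insert w (insert v S))) < card (free_places K S)"
proof -
  have S: "finite S" "blow_up F K S" "even (card (free_places K S))"
    using assms(2) by (simp_all add: balanced_def)
  have after_v: "card (free_places K S) = Suc (card (free_places K (insert v S)))"
    using assms(1) S(1) assms(3) by (rule card_free_places_insert_free_place)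
  with S(3) have "free_places K (insert v S) \<noteq> {}" by auto
  then obtain w where w: "w \<in> free_places K (insert v S)" by blast
  have after_w: "card (free_places K (insert v S)) =
      Suc (card (free_places K (insert w (insert v S))))"
    using S(1) by (intro card_free_places_insert_free_place[OF assms(1) _ w]) simp
  have "v \<in> moves (blow_up F K) S" using S(2) assms(3) by (simp add: moves_blow_up)
  then have w_move: "w \<in> moves (blow_up F K) (insert v S)"
    using w by (simp add: blow_up_insert moves_blow_up)
  show thesis
    by (rule that[OF w w_move])
      (use S after_v after_w blow_up_insert[OF w_move] in \<open>simp_all add: balanced_def\<close>)
qed

text \<open>A move in an opened fibre is answered by another one until a new fibre is opened.\<close>

lemma mover_loses_blow_upI:
  assumes K: "finite K" "odd (card K)" and "moves F (fst ` S) \<noteq> {}" "balanced F K S"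
    and "\<And>g T. g \<in> moves F (fst ` S) \<Longrightarrow> fst ` T = insert g (fst ` S) \<Longrightarrow>
      balanced F K T \<Longrightarrow> mover_wins (blow_up F K) T"
  shows "mover_loses (blow_up F K) S"
  using assms(3-5)
proof (induction "card (free_places K S)" arbitrary: S rule: less_induct)
  case less
  have moves: "moves (blow_up F K) S = moves F (fst ` S) \<times> K \<union> free_places K S"
    using less.prems(2) by (simp add: balanced_def moves_blow_up)
  have "K \<noteq> {}" using K by auto
  with less.prems(1) have "moves (blow_up F K) S \<noteq> {}" by (simp add: moves)
  moreover have "mover_wins (blow_up F K) (insert v S)" if v: "v \<in> moves (blow_up F K) S" for v
  proof (cases "v \<in> free_places K S")
    case True
    obtain w where w: "w \<in> free_places K (insert v S)" "w \<in> moves (blow_up F K) (insert v S)"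
      "balanced F K (insert w (insert v S))"
      "card (free_places K (insert w (insert v S))) < card (free_places K S)"
      by (rule balanced_reply[OF K(1) less.prems(2) True])
    have "fst ` insert w (insert v S) = fst ` S"
      using fst_image_insert_free_place[OF w(1)] fst_image_insert_free_place[OF True] by simp
    then have "mover_loses (blow_up F K) (insert w (insert v S))"
      using less.hyps[OF w(4) _ w(3)] less.prems(1,3) by simp
    with w(2) show ?thesis by (rule mover_wins_mover_loses.some_move)
  next
    case False
    with v obtain g h where v_eq: "v = (g, h)" and g: "g \<in> moves F (fst ` S)" and "h \<in> K"
      by (auto simp: moves)
    show ?thesis
      using g _ balanced_insert_new(2)[OF K less.prems(2) g \<open>h \<in> K\<close>] unfolding v_eq
      by (rule less.prems(3)) simp
  qed
  ultimately show ?case by (rule mover_wins_mover_loses.all_moves)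
qed

lemma mover_blow_up_of_mover:
  assumes K: "finite K" "odd (card K)"
  shows "mover_wins F P \<Longrightarrow> fst ` S = P \<Longrightarrow> balanced F K S \<Longrightarrow> mover_wins (blow_up F K) S"
    and "mover_loses F P \<Longrightarrow> fst ` S = P \<Longrightarrow> balanced F K S \<Longrightarrow> mover_loses (blow_up F K) S"
proof (induction P and P arbitrary: S and S rule: mover_wins_mover_loses.inducts)
  case (stuck P)
  then show ?case using mover_blow_up_maximal[OF K(1)] unfolding balanced_def by blast
next
  case (some_move g P)
  obtain h where "h \<in> K" using K by fastforce
  with some_move have new: "(g, h) \<in> moves (blow_up F K) S" "balanced F K (insert (g, h) S)"
    using balanced_insert_new[OF K, of F S g h] by simp_all
  note new(1)
  moreover have "mover_loses (blow_up F K) (insert (g, h) S)"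
    using new(2) some_move.prems(1) by (intro some_move.IH(3)) simp_all
  ultimately show ?case by (rule mover_wins_mover_loses.some_move)
next
  case (all_moves P)
  then show ?case by (intro mover_loses_blow_upI[OF K]) simp_all
qed

lemma mover_loses_blow_up_imp_moves:
  assumes "finite K" "balanced F K S" "mover_loses (blow_up F K) S"
  shows "moves F (fst ` S) \<noteq> {}"
  using mover_blow_up_maximal[OF assms(1)] assms(2,3) unfolding balanced_def by blast

text \<open>In the second part, \<open>S\<close> becomes balanced by the selection of \<open>v\<close>: this is the position between
  two moves in opened fibres.\<close>

lemma mover_of_mover_blow_up:
  assumes K: "finite K" "odd (card K)"
  shows "mover_wins (blow_up F K) S \<Longrightarrow> balanced F K S \<Longrightarrow> mover_wins F (fst ` S)"
    and "mover_loses (blow_up F K) S \<Longrightarrow> (balanced F K S \<longrightarrow> mover_loses F (fst ` S)) \<and>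
      (\<forall>v\<in>free_places K S. balanced F K (insert v S) \<longrightarrow> mover_wins F (fst ` S))"
proof (induction S and S rule: mover_wins_mover_loses.inducts)
  case (stuck S)
  have "K \<noteq> {}" using K by auto
  with stuck have "moves F (fst ` S) = {}" by (auto simp: balanced_def moves_blow_up)
  then show ?case by (rule mover_wins_mover_loses.stuck)
next
  case (some_move v S)
  show ?case
  proof (cases "v \<in> free_places K S")
    case True
    with some_move.IH(3) balanced_reply[OF K(1) some_move.prems True]
    have "mover_wins F (fst ` insert v S)" by blast
    then show ?thesis by (simp only: fst_image_insert_free_place[OF True])
  next
    case False
    with some_move obtain g h where v: "v = (g, h)" and g: "g \<in> moves F (fst ` S)" and "h \<in> K"
      by (auto simp: balanced_def moves_blow_up)
    have "mover_loses F (insert g (fst ` S))"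
      using some_move.IH(3) balanced_insert_new(2)[OF K some_move.prems g \<open>h \<in> K\<close>] v by simp
    with g show ?thesis by (rule mover_wins_mover_loses.some_move)
  qed
next
  case (all_moves S)
  have "mover_loses F (fst ` S)" if "balanced F K S"
  proof (rule mover_wins_mover_loses.all_moves)
    show "moves F (fst ` S) \<noteq> {}"
      using K(1) that mover_wins_mover_loses.all_moves[OF all_moves.IH(1,2)]
      by (rule mover_loses_blow_up_imp_moves)
    fix g assume g: "g \<in> moves F (fst ` S)"
    obtain h where "h \<in> K" using K by fastforce
    from all_moves.IH(3)[OF balanced_insert_new[OF K that g this]]
    show "mover_wins F (insert g (fst ` S))" by simp
  qed
  moreover have "mover_wins F (fst ` S)"
    if v: "v \<in> free_places K S" "balanced F K (insert v S)" for v
  proof -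
    have "v \<in> moves (blow_up F K) S"
      using v by (simp add: balanced_def moves_def free_places_def)
    from all_moves.IH(3)[OF this v(2)] show ?thesis
      by (simp only: fst_image_insert_free_place[OF v(1)])
  qed
  ultimately show ?case by blast
qed

lemma mover_loses_blow_up_odd_iff:
  assumes "finite K" "odd (card K)" "F {}"
  shows "mover_loses (blow_up F K) {} \<longleftrightarrow> mover_loses F {}"
proof -
  have "balanced F K {}"
    using assms(3) by (simp add: balanced_def blow_up_def free_places_def)
  then show ?thesis
    using mover_blow_up_of_mover(2)[OF assms(1,2), of F "{}" "{}"]
      mover_of_mover_blow_up(2)[OF assms(1,2), of F "{}"] by auto
qed

lemma not_mover_loses_blow_up_even:
  assumes "even (card K)" "F {}"
  shows "\<not> mover_loses (blow_up F K) {}"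
proof
  have "even (card S)" if "blow_up F K S" "moves (blow_up F K) S = {}" for S
  proof -
    have "S = fst ` S \<times> K"
      using that moves_blow_up[OF that(1)] by (force simp: free_places_def blow_up_def)
    then have "card S = card (fst ` S) * card K" by (metis card_cartesian_product)
    then show ?thesis using assms(1) by simp
  qed
  moreover assume "mover_loses (blow_up F K) {}"
  ultimately show False
    using even_maximal_sets_parity(2)[of "blow_up F K" "{}"] assms(2) by (simp add: blow_up_def)
qed

theorem theorem5p4:
  fixes G :: "'a pair_pre_digraph" and K :: "'b pair_pre_digraph" and n :: nat
  assumes "simple_graph G"
    and "Digraph_Component.connected (with_proj G)"
    and "n \<ge> 1"
    and "complete_digraph n (with_proj K)"
  shows "wins_avoidance_game Player_B (lexicographic_product G K) \<longleftrightarrow>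
    wins_avoidance_game Player_B G \<and> odd n"
proof -
  let ?F = "general_position_set G" and ?K = "pverts K"
  have K: "finite ?K" "card ?K = n" "parcs K = {(h, h'). (h, h') \<in> ?K \<times> ?K \<and> h \<noteq> h'}"
    using assms(4) by (simp_all add: complete_digraph_pair_def)
  have empty: "?F {}" by (simp add: general_position_set_def)
  have "pairwise (\<lambda>h h'. (h, h') \<in> parcs K) ?K" by (simp add: pairwise_def K(3))
  then have "general_position_set (lexicographic_product G K) = blow_up ?F ?K"
    by (simp add: fun_eq_iff blow_up_def general_position_set_lexicographic_product)
  then have product: "wins_avoidance_game Player_B (lexicographic_product G K) \<longleftrightarrow>
      mover_loses (blow_up ?F ?K) {}"
    by (simp add: wins_avoidance_game_iff)
  show ?thesis
  proof (cases "odd n")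
    case True
    then show ?thesis
      using product K(1,2) empty by (simp add: mover_loses_blow_up_odd_iff wins_avoidance_game_iff)
  next
    case False
    then show ?thesis
      using product K(2) empty by (simp add: not_mover_loses_blow_up_even)
  qed
qed

end
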